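(* Let $m \geq 1$, let $(a_1,\dots,a_n)$ be a sequence of positive integers, let $\mathcal{G} = \mathcal{G}[a_1,\dots,a_n]$ be the associated border strip, and let \[ X_{\mathcal{G}}(q) = \Lambda_m^+(q,a_1)\Lambda_m^-(q,a_2)\Lambda_m^+(q,a_3)\Lambda_m^-(q,a_4)\cdots\Lambda_m^{\pm}(q,a_n), \] the factors alternating between $\Lambda_m^+$ (odd positions) and $\Lambda_m^-$ (even positions). Then for all $1 \leq i,j \leq m+1$, \[ X_{\mathcal{G}}(q)_{ij} = \begin{cases} q^{m+1-j}\, \Omega_m^{ij}(\mathcal{G},q) & \text{if } n \text{ is even},\\ q^{j-1}\, \overline{\Omega}_m^{ij}(\mathcal{G},q) & \text{if } n \text{ is odd}. \end{cases} \]
   Context: Matrices (all $(m+1)\times(m+1)$, indices $1,\dots,m+1$): $R_m$ is upper triangular with all entries on/above the diagonal equal to $1$; $L_m = R_m^\top$; $Q_m = \mathrm{diag}(q^m,q^{m-1},\dots,q,1)$; $R_m(q) = R_mQ_m$, $L_m(q) = L_mQ_m$; $W_m$ is the anti-diagonal permutation matrix (ones on the anti-diagonal, zeros elsewhere). For a positive integer $a$, $\Lambda_m^+(q,a) := R_m(q)^aW_m$ and $\Lambda_m^-(q,a) := W_mL_m(q)^a$. Border strip: for positive integers $a_1,\dots,a_n$, $\mathcal{G}[a_1,\dots,a_n]$ is a set of unit boxes $b_1,\dots,b_N$ in the plane with $N = a_1+\cdots+a_n-1$. If $n=1$, it is a vertical column of $a_1-1$ boxes, indexed bottom to top. If $n\geq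 2$, each box $b_{t+1}$ is placed either directly above or directly to the right of $b_t$, with the sequence of steps being: $a_1-1$ up steps, then $a_2$ right steps, then $a_3$ up steps, then $a_4$ right steps, etc., alternating, and ending with $a_n-1$ steps (right if $n$ is even, up if $n$ is odd). Thus boxes are indexed from bottom-left to top-right. A $P$-partition (reverse plane partition) of $\mathcal{G}$ with parts at most $m$ is a map $\sigma$ from the boxes to $\{0,1,\dots,m\}$ that is weakly increasing along each row from left to right and along each column from top to bottom. Its weight is $\mathrm{wt}(\sigma) = \sum_t \sigma(b_t)$. Let $\Omega_m(\mathcal{G})$ be the set of these. $\Omega_m^{ij}(\mathcal{G})$ is the subset with $\sigma(b_1) \leq m+1-i$ and $\sigma(b_N) \leq m+1-j$; $\overline{\Omega}_m^{ij}(\mathcal{G})$ is the subset with $\sigma(b_1) \leq m+1-i$ and $\sigma(b_N) \geq j-1$. The generating functions are $\Omega_m^{ij}(\mathcal{G},q) = \sum_{\sigma \in \Omega_m^{ij}(\mathcal{G})} q^{\mathrm{wt}(\sigma)}$ and similarly $\overline{\Omega}_m^{ij}(\mathcal{G},q)$.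
   Formalization: For the one-term sequence (1) the border strip is empty, so b_1 and b_N do not exist and the conditions on them are undefined; there the condition defining the set in the odd case is read as j-1 ≤ m+1-i. *)

theory Defs
  imports "Jordan_Normal_Form.Matrix" "HOL-Library.FuncSet"
begin

(* Matrices and lists are indexed from 0, so entry (r, c) below is entry (r + 1, c + 1) in
   one-based notation; the parameter q ranges over a commutative ring, which includes the
   case of the indeterminate of a polynomial ring. *)

definition R_mat :: "nat \<Rightarrow> 'a::comm_ring_1 mat" where
  "R_mat m = mat (m + 1) (m + 1) (\<lambda>(r, c). if r \<le> c then 1 else 0)"

definition L_mat :: "nat \<Rightarrow> 'a::comm_ring_1 mat" where
  "L_mat m = transpose_mat (R_mat m)"

definition Q_mat :: "nat \<Rightarrow> 'a::comm_ring_1 \<Rightarrow> 'a mat" where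
  "Q_mat m q = mat (m + 1) (m + 1) (\<lambda>(r, c). if r = c then q ^ (m - r) else 0)"

definition W_mat :: "nat \<Rightarrow> 'a::comm_ring_1 mat" where
  "W_mat m = mat (m + 1) (m + 1) (\<lambda>(r, c). if r + c = m then 1 else 0)"

definition Rq_mat :: "nat \<Rightarrow> 'a::comm_ring_1 \<Rightarrow> 'a mat" where
  "Rq_mat m q = R_mat m * Q_mat m q"

definition Lq_mat :: "nat \<Rightarrow> 'a::comm_ring_1 \<Rightarrow> 'a mat" where
  "Lq_mat m q = L_mat m * Q_mat m q"

definition Lambda_plus :: "nat \<Rightarrow> 'a::comm_ring_1 \<Rightarrow> nat \<Rightarrow> 'a mat" where
  "Lambda_plus m q a = (Rq_mat m q ^\<^sub>m a) * W_mat m"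

definition Lambda_minus :: "nat \<Rightarrow> 'a::comm_ring_1 \<Rightarrow> nat \<Rightarrow> 'a mat" where
  "Lambda_minus m q a = W_mat m * (Lq_mat m q ^\<^sub>m a)"

definition X_mat :: "nat \<Rightarrow> 'a::comm_ring_1 \<Rightarrow> nat list \<Rightarrow> 'a mat" where
  "X_mat m q as =
     foldr (*) (map (\<lambda>k. if even k then Lambda_plus m q (as ! k) else Lambda_minus m q (as ! k))
                  [0..<length as])
       (1\<^sub>m (m + 1))"

(* A box is given by the pair (x, y) of its horizontal and vertical coordinates; x increases to
   the right and y increases upwards. *)

type_synonym box = "int \<times> int"

datatype direction = Upwards | Rightwards

fun move :: "box \<Rightarrow> direction \<Rightarrow> box" where
  "move (x, y) Upwards = (x, y + 1)"
| "move (x, y) Rightwards = (x + 1, y)"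

(* Both the first and the last run of steps are shortened by one; for a one-term sequence [a]
   this is the same run, which gives the a - 2 steps of a column of a - 1 boxes. *)

definition run_length :: "nat list \<Rightarrow> nat \<Rightarrow> nat" where
  "run_length as k =
     as ! k - (if k = 0 then 1 else 0) - (if k = length as - 1 then 1 else 0)"

definition strip_steps :: "nat list \<Rightarrow> direction list" where
  "strip_steps as =
     concat (map (\<lambda>k. replicate (run_length as k) (if even k then Upwards else Rightwards))
               [0..<length as])"

definition num_boxes :: "nat list \<Rightarrow> nat" where
  "num_boxes as = sum_list as - 1"

(* The box b_t, for t = 1, ..., num_boxes as. *)

definition strip_box :: "nat list \<Rightarrow> nat \<Rightarrow> box" where
  "strip_box as t = foldl move (0, 0) (take (t - 1) (strip_steps as))"

definition border_strip :: "nat list \<Rightarrow> box set" where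
  "border_strip as = strip_box as ` {1..num_boxes as}"

(* Rows increase weakly from left to right, columns from top to bottom. *)

definition P_partitions :: "nat \<Rightarrow> box set \<Rightarrow> (box \<Rightarrow> nat) set" where
  "P_partitions m G =
     {\<sigma> \<in> G \<rightarrow>\<^sub>E {0..m}.
        (\<forall>x x' y. (x, y) \<in> G \<and> (x', y) \<in> G \<and> x \<le> x' \<longrightarrow> \<sigma> (x, y) \<le> \<sigma> (x', y)) \<and>
        (\<forall>x y y'. (x, y) \<in> G \<and> (x, y') \<in> G \<and> y \<le> y' \<longrightarrow> \<sigma> (x, y') \<le> \<sigma> (x, y))}"

definition wt :: "box set \<Rightarrow> (box \<Rightarrow> nat) \<Rightarrow> nat" where
  "wt G \<sigma> = (\<Sum>b\<in>G. \<sigma> b)"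

(* The indices i and j are one-based, 1 \<le> i, j \<le> m + 1.

   The strip of the sequence [1] has no boxes, hence no first and no last box.  In a
   nonempty column the two bounds in Omega_bar are the ends of the chain
   m + 1 - i \<ge> \<sigma>(b_1) \<ge> ... \<ge> \<sigma>(b_N) \<ge> j - 1; for the empty strip they are read as what
   remains of this chain, namely j - 1 \<le> m + 1 - i. The one-term sequence [1] has odd length,
   so the reading of the bounds in Omega for the empty strip (no constraint) is immaterial to
   sequences of even length. *)

definition Omega :: "nat \<Rightarrow> nat list \<Rightarrow> nat \<Rightarrow> nat \<Rightarrow> (box \<Rightarrow> nat) set" where
  "Omega m as i j =
     {\<sigma> \<in> P_partitions m (border_strip as).
        num_boxes as > 0 \<longrightarrow>
          \<sigma> (strip_box as 1) \<le> m + 1 - i \<and> \<sigma> (strip_box as (num_boxes as)) \<le> m + 1 - j}"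

definition Omega_bar :: "nat \<Rightarrow> nat list \<Rightarrow> nat \<Rightarrow> nat \<Rightarrow> (box \<Rightarrow> nat) set" where
  "Omega_bar m as i j =
     {\<sigma> \<in> P_partitions m (border_strip as).
        if num_boxes as = 0 then j - 1 \<le> m + 1 - i
        else \<sigma> (strip_box as 1) \<le> m + 1 - i \<and> \<sigma> (strip_box as (num_boxes as)) \<ge> j - 1}"

definition Omega_gf :: "nat \<Rightarrow> nat list \<Rightarrow> nat \<Rightarrow> nat \<Rightarrow> 'a::comm_ring_1 \<Rightarrow> 'a" where
  "Omega_gf m as i j q = (\<Sum>\<sigma>\<in>Omega m as i j. q ^ wt (border_strip as) \<sigma>)"

definition Omega_bar_gf :: "nat \<Rightarrow> nat list \<Rightarrow> nat \<Rightarrow> nat \<Rightarrow> 'a::comm_ring_1 \<Rightarrow> 'a" where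
  "Omega_bar_gf m as i j q = (\<Sum>\<sigma>\<in>Omega_bar m as i j. q ^ wt (border_strip as) \<sigma>)"

end

theory Submission
  imports Defs
begin

text \<open>
  Conjugation by the involution \<open>W\<close> turns \<open>R(q)\<close> and \<open>L(q)\<close> into the transfer matrices
  of a weakly decreasing and a weakly increasing step, in which arriving at height \<open>z\<close>
  contributes the factor \<open>q ^ z\<close>. The inner copies of \<open>W\<close> cancel, so \<open>X\<close> becomes a product of
  transfer matrices along the steps of the strip, preceded by one step into the first box and
  followed by one step out of the last box. Its entries enumerate the sequences of
  heights along the strip: the first step gives the bound on \<open>\<sigma>(b\<^sub>1)\<close>, the last one the bound on
  \<open>\<sigma>(b\<^sub>N)\<close> and the extra power of \<open>q\<close>.
\<close>

subsection \<open>Transfer matrices\<close>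

text \<open>Compares the value of a box with that of the next one: going up lowers values weakly
  because columns increase from top to bottom.\<close>

fun step_rel :: "direction \<Rightarrow> nat \<Rightarrow> nat \<Rightarrow> bool" where
  "step_rel Upwards x y \<longleftrightarrow> y \<le> x"
| "step_rel Rightwards x y \<longleftrightarrow> x \<le> y"

definition transfer_mat :: "nat \<Rightarrow> 'a::comm_ring_1 \<Rightarrow> direction \<Rightarrow> 'a mat" where
  "transfer_mat m q d = mat (m + 1) (m + 1) (\<lambda>(x, z). if step_rel d x z then q ^ z else 0)"

definition mat_prod :: "nat \<Rightarrow> 'a::comm_ring_1 mat list \<Rightarrow> 'a mat" where
  "mat_prod N As = foldr (*) As (1\<^sub>m N)"

definition path_mat :: "nat \<Rightarrow> 'a::comm_ring_1 \<Rightarrow> direction list \<Rightarrow> 'a mat" where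
  "path_mat m q ds = mat_prod (m + 1) (map (transfer_mat m q) ds)"

lemma transfer_mat_carrier [simp]: "transfer_mat m q d \<in> carrier_mat (m + 1) (m + 1)"
  by (simp add: transfer_mat_def)

lemma W_mat_carrier [simp]: "W_mat m \<in> carrier_mat (m + 1) (m + 1)"
  by (simp add: W_mat_def)

lemma Rq_mat_carrier [simp]: "Rq_mat m q \<in> carrier_mat (m + 1) (m + 1)"
  by (auto simp: Rq_mat_def R_mat_def Q_mat_def)

lemma Lq_mat_carrier [simp]: "Lq_mat m q \<in> carrier_mat (m + 1) (m + 1)"
  by (auto simp: Lq_mat_def L_mat_def R_mat_def Q_mat_def)

lemma mat_prod_carrier:
  "set As \<subseteq> carrier_mat N N \<Longrightarrow> mat_prod N As \<in> carrier_mat N N"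
  by (induction As) (auto simp: mat_prod_def)

lemma mat_prod_append:
  assumes "set As \<subseteq> carrier_mat N N" "set Bs \<subseteq> carrier_mat N N"
  shows "mat_prod N (As @ Bs) = mat_prod N As * mat_prod N Bs"
  using assms(1)
proof (induction As)
  case Nil
  then show ?case using mat_prod_carrier[OF assms(2)] by (simp add: mat_prod_def)
next
  case (Cons A As)
  have "mat_prod N (A # As @ Bs) = A * (mat_prod N As * mat_prod N Bs)"
    using Cons by (simp add: mat_prod_def)
  also have "\<dots> = A * mat_prod N As * mat_prod N Bs"
    using Cons.prems mat_prod_carrier[of As N] mat_prod_carrier[OF assms(2)]
    by (intro assoc_mult_mat[symmetric]) auto
  finally show ?case by (simp add: mat_prod_def)
qed

lemma path_mat_carrier [simp]: "path_mat m q ds \<in> carrier_mat (m + 1) (m + 1)"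
  unfolding path_mat_def by (rule mat_prod_carrier) (use transfer_mat_carrier in auto)

lemma path_mat_append: "path_mat m q (ds @ es) = path_mat m q ds * path_mat m q es"
  unfolding path_mat_def map_append
  by (rule mat_prod_append) (use transfer_mat_carrier in auto)

lemma path_mat_Nil: "path_mat m q [] = 1\<^sub>m (m + 1)"
  by (simp add: path_mat_def mat_prod_def)

lemma path_mat_Cons: "path_mat m q (d # ds) = transfer_mat m q d * path_mat m q ds"
  by (simp add: path_mat_def mat_prod_def)

lemma path_mat_replicate: "path_mat m q (replicate a d) = transfer_mat m q d ^\<^sub>m a"
proof (induction a)
  case 0
  then show ?case using transfer_mat_carrier[of m q d] by (simp add: path_mat_Nil)
next
  case (Suc a)
  have "path_mat m q [d] = transfer_mat m q d"
    unfolding path_mat_Cons path_mat_Nil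
    by (rule right_mult_one_mat[OF transfer_mat_carrier])
  \<comment> \<open>Matrix powers gain their new factor on the right, while \<open>replicate\<close>
    grows at the head; the added step is therefore moved to the end of the list.\<close>
  then show ?case
    using Suc by (simp add: replicate_append_same[symmetric] path_mat_append del: replicate_Suc)
      (simp add: path_mat_append replicate_append_same[symmetric])
qed

section \<open>Entries of products with \<open>W\<close> and \<open>Q\<close>\<close>

lemma index_mult_sum:
  assumes "A \<in> carrier_mat N N" "B \<in> carrier_mat N N" "r < N" "c < N"
  shows "(A * B) $$ (r, c) = (\<Sum>k<N. A $$ (r, k) * B $$ (k, c))"
  using assms by (auto simp: scalar_prod_def lessThan_atLeast0 intro!: sum.cong)

text \<open>Only \<open>k = m - r\<close> survives. As \<open>W\<close> is symmetric, the same sum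
  serves multiplication by \<open>W\<close> from either side.\<close>

lemma sum_W_left:
  fixes f :: "nat \<Rightarrow> 'a::comm_ring_1" and r m :: nat
  assumes "r \<le> m"
  shows "(\<Sum>k<m + 1. (if r + k = m then 1 else 0) * f k) = f (m - r)"
proof -
  have "(\<Sum>k<m + 1. (if r + k = m then 1 else 0) * f k) = (\<Sum>k<m + 1. if k = m - r then f k else 0)"
    using assms by (intro sum.cong) auto
  then show ?thesis using assms by simp
qed

lemma W_mult_index:
  assumes "A \<in> carrier_mat (m + 1) (m + 1)" "r \<le> m" "c \<le> m"
  shows "(W_mat m * A) $$ (r, c) = A $$ (m - r, c)"
proof -
  have "(W_mat m * A) $$ (r, c) = (\<Sum>k<m + 1. (if r + k = m then 1 else 0) * A $$ (k, c))"
    using assms by (subst index_mult_sum[OF W_mat_carrier]) (auto simp: W_mat_def intro!: sum.cong)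
  also have "\<dots> = A $$ (m - r, c)" by (rule sum_W_left[OF assms(2)])
  finally show ?thesis .
qed

lemma mult_W_index:
  assumes "A \<in> carrier_mat (m + 1) (m + 1)" "r \<le> m" "c \<le> m"
  shows "(A * W_mat m) $$ (r, c) = A $$ (r, m - c)"
proof -
  have "(A * W_mat m) $$ (r, c) = (\<Sum>k<m + 1. (if c + k = m then 1 else 0) * A $$ (r, k))"
    using assms
    by (subst index_mult_sum[OF _ W_mat_carrier]) (auto simp: W_mat_def add.commute intro!: sum.cong)
  also have "\<dots> = A $$ (r, m - c)" by (rule sum_W_left[OF assms(3)])
  finally show ?thesis .
qed

lemma mult_Q_index:
  assumes "A \<in> carrier_mat (m + 1) (m + 1)" "r \<le> m" "c \<le> m"
  shows "(A * Q_mat m q) $$ (r, c) = A $$ (r, c) * q ^ (m - c)"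
proof -
  have "(A * Q_mat m q) $$ (r, c) = (\<Sum>k<m + 1. A $$ (r, k) * Q_mat m q $$ (k, c))"
    by (rule index_mult_sum[OF assms(1)]) (use assms in \<open>auto simp: Q_mat_def\<close>)
  also have "\<dots> = (\<Sum>k<m + 1. if k = c then A $$ (r, k) * q ^ (m - k) else 0)"
    by (intro sum.cong refl) (use assms in \<open>auto simp: Q_mat_def\<close>)
  also have "\<dots> = A $$ (r, c) * q ^ (m - c)"
    using assms by (simp del: sum.lessThan_Suc)
  finally show ?thesis .
qed

lemma Rq_mat_index: "r \<le> m \<Longrightarrow> c \<le> m \<Longrightarrow> Rq_mat m q $$ (r, c) = (if r \<le> c then q ^ (m - c) else 0)"
  unfolding Rq_mat_def by (subst mult_Q_index) (auto simp: R_mat_def)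

lemma Lq_mat_index: "r \<le> m \<Longrightarrow> c \<le> m \<Longrightarrow> Lq_mat m q $$ (r, c) = (if c \<le> r then q ^ (m - c) else 0)"
  unfolding Lq_mat_def by (subst mult_Q_index) (auto simp: R_mat_def L_mat_def)

section \<open>Passing \<open>W\<close> through \<open>R(q)\<close> and \<open>L(q)\<close>\<close>

lemma W_mult_W: "W_mat m * W_mat m = (1\<^sub>m (m + 1) :: 'a::comm_ring_1 mat)"
proof (rule eq_matI)
  fix r c assume "r < dim_row (1\<^sub>m (m + 1) :: 'a mat)" "c < dim_col (1\<^sub>m (m + 1) :: 'a mat)"
  then show "(W_mat m * W_mat m) $$ (r, c) = (1\<^sub>m (m + 1) :: 'a mat) $$ (r, c)"
    by (subst W_mult_index) (auto simp: W_mat_def)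
qed (auto simp: W_mat_def)

text \<open>Reflecting the column index turns the weight \<open>q ^ (m - (m - c))\<close> into
  \<open>q ^ c\<close>, and the condition \<open>r \<le> m - c\<close> is the same as
  \<open>c \<le> m - r\<close>: row index \<open>r\<close> stands for height
  \<open>m - r\<close>.\<close>

lemma Rq_mult_W: "Rq_mat m q * W_mat m = W_mat m * transfer_mat m q Upwards"
proof (rule eq_matI)
  fix r c
  assume "r < dim_row (W_mat m * transfer_mat m q Upwards)"
    and "c < dim_col (W_mat m * transfer_mat m q Upwards)"
  then have "r \<le> m" "c \<le> m" by (auto simp: W_mat_def transfer_mat_def)
  then show "(Rq_mat m q * W_mat m) $$ (r, c) = (W_mat m * transfer_mat m q Upwards) $$ (r, c)"
    unfolding mult_W_index[OF Rq_mat_carrier \<open>r \<le> m\<close> \<open>c \<le> m\<close>]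
      W_mult_index[OF transfer_mat_carrier \<open>r \<le> m\<close> \<open>c \<le> m\<close>]
    by (auto simp: Rq_mat_index transfer_mat_def)
qed (use Rq_mat_carrier[of m q] transfer_mat_carrier[of m q] in \<open>auto simp: W_mat_def transfer_mat_def\<close>)

text \<open>The transfer matrix now stands to the left of \<open>W\<close>, opposite to
  \<open>Rq_mult_W\<close>; this is what brings the inner copies of \<open>W\<close> together in
  pairs.\<close>

lemma W_mult_Lq: "W_mat m * Lq_mat m q = transfer_mat m q Rightwards * W_mat m"
proof (rule eq_matI)
  fix r c
  assume "r < dim_row (transfer_mat m q Rightwards * W_mat m)"
    and "c < dim_col (transfer_mat m q Rightwards * W_mat m)"
  then have "r \<le> m" "c \<le> m" by (auto simp: W_mat_def transfer_mat_def)
  then show "(W_mat m * Lq_mat m q) $$ (r, c) = (transfer_mat m q Rightwards * W_mat m) $$ (r, c)"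
    unfolding mult_W_index[OF transfer_mat_carrier \<open>r \<le> m\<close> \<open>c \<le> m\<close>]
      W_mult_index[OF Lq_mat_carrier \<open>r \<le> m\<close> \<open>c \<le> m\<close>]
    by (auto simp: Lq_mat_index transfer_mat_def)
qed (use Lq_mat_carrier[of m q] transfer_mat_carrier[of m q] in \<open>auto simp: W_mat_def transfer_mat_def\<close>)

lemma pow_mat_intertwine:
  assumes "A \<in> carrier_mat N N" "B \<in> carrier_mat N N" "C \<in> carrier_mat N N"
    and "A * C = C * B"
  shows "(A ^\<^sub>m k) * C = C * (B ^\<^sub>m k)"
proof (induction k)
  case 0
  then show ?case using assms by simp
next
  case (Suc k)
  have AB: "A ^\<^sub>m k \<in> carrier_mat N N" "B ^\<^sub>m k \<in> carrier_mat N N"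
    using assms by (auto intro: pow_carrier_mat)
  have "A ^\<^sub>m Suc k * C = A ^\<^sub>m k * (C * B)"
    using assms AB by (simp add: assoc_mult_mat[of _ N N _ N _ N])
  also have "\<dots> = C * B ^\<^sub>m k * B"
    using assms AB Suc by (simp add: assoc_mult_mat[of _ N N _ N _ N, symmetric])
  also have "\<dots> = C * B ^\<^sub>m Suc k"
    using assms AB by (simp add: assoc_mult_mat[of _ N N _ N _ N])
  finally show ?case .
qed

lemma Lambda_plus_eq: "Lambda_plus m q a = W_mat m * path_mat m q (replicate a Upwards)"
  unfolding Lambda_plus_def path_mat_replicate
  by (rule pow_mat_intertwine[OF Rq_mat_carrier transfer_mat_carrier W_mat_carrier Rq_mult_W])

lemma Lambda_minus_eq: "Lambda_minus m q a = path_mat m q (replicate a Rightwards) * W_mat m"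
  unfolding Lambda_minus_def path_mat_replicate
  by (rule pow_mat_intertwine[symmetric,
        OF transfer_mat_carrier Lq_mat_carrier W_mat_carrier W_mult_Lq[symmetric]])

section \<open>Cancellation in the alternating product\<close>

definition run_dir :: "nat \<Rightarrow> direction" where
  "run_dir k = (if even k then Upwards else Rightwards)"

definition full_steps :: "nat list \<Rightarrow> direction list" where
  "full_steps as = concat (map (\<lambda>k. replicate (as ! k) (run_dir k)) [0..<length as])"

text \<open>For even \<open>n\<close> the product ends in \<open>W\<close>, which cancels against
  the leading \<open>W\<close> of the next \<open>Lambda_plus\<close>; for odd \<open>n\<close> the
  next \<open>Lambda_minus\<close> supplies a new final \<open>W\<close>. The case
  \<open>n = 0\<close> fits since \<open>W * W = 1\<close>. A function \<open>f\<close> replaces the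
  list so that induction can split off the last factor.\<close>

lemma mat_prod_Lambda:
  fixes q :: "'a::comm_ring_1"
  shows "mat_prod (m + 1)
      (map (\<lambda>k. if even k then Lambda_plus m q (f k) else Lambda_minus m q (f k)) [0..<n]) =
    W_mat m * path_mat m q (concat (map (\<lambda>k. replicate (f k) (run_dir k)) [0..<n])) *
      (if even n then W_mat m else 1\<^sub>m (m + 1))"
proof (induction n)
  case 0
  have "W_mat m * 1\<^sub>m (m + 1) * W_mat m = (1\<^sub>m (m + 1) :: 'a mat)"
    unfolding right_mult_one_mat[OF W_mat_carrier] by (rule W_mult_W)
  then show ?case by (simp add: mat_prod_def path_mat_Nil)
next
  case (Suc n)
  let ?L = "\<lambda>k. if even k then Lambda_plus m q (f k) else Lambda_minus m q (f k)"
  let ?P = "path_mat m q (concat (map (\<lambda>k. replicate (f k) (run_dir k)) [0..<n]))"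
  let ?D = "path_mat m q (replicate (f n) (run_dir n))"
  let ?W = "W_mat m :: 'a mat" and ?E = "1\<^sub>m (m + 1) :: 'a mat"
  note carr = W_mat_carrier path_mat_carrier one_carrier_mat mult_carrier_mat[of _ "m+1" "m+1" _ "m+1"]
  note assoc = assoc_mult_mat[of _ "m+1" "m+1" _ "m+1" _ "m+1"]
  have WP: "?W * ?P \<in> carrier_mat (m + 1) (m + 1)"
    and WPD: "?W * (?P * ?D) \<in> carrier_mat (m + 1) (m + 1)"
    and L: "?L k \<in> carrier_mat (m + 1) (m + 1)" for k
    unfolding Lambda_plus_eq Lambda_minus_eq by (auto intro!: carr simp del: One_nat_def add_Suc_right)
  have "mat_prod (m + 1) (map ?L [0..<Suc n]) = mat_prod (m + 1) (map ?L [0..<n] @ [?L n])"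
    by simp
  also have "\<dots> = mat_prod (m + 1) (map ?L [0..<n]) * mat_prod (m + 1) [?L n]"
  proof (rule mat_prod_append)
    show "set (map ?L [0..<n]) \<subseteq> carrier_mat (m + 1) (m + 1)"
      unfolding set_map by (rule image_subsetI) (rule L)
    show "set [?L n] \<subseteq> carrier_mat (m + 1) (m + 1)" using L[of n] by simp
  qed
  also have "mat_prod (m + 1) [?L n] = ?L n"
    using L[of n] unfolding mat_prod_def by simp
  also have "mat_prod (m + 1) (map ?L [0..<n]) * ?L n =
      ?W * (?P * ?D) * (if even (Suc n) then W_mat m else 1\<^sub>m (m + 1))"
  proof (cases "even n")
    case True
    have "?W * ?P * ?W * (?W * ?D) = ?W * ?P * (?W * ?W) * ?D"
      by (simp add: assoc carr del: One_nat_def add_Suc_right)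
    also have "\<dots> = ?W * ?P * ?D"
      unfolding W_mult_W right_mult_one_mat[OF WP] ..
    also have "\<dots> = ?W * (?P * ?D)" by (rule assoc[OF W_mat_carrier path_mat_carrier path_mat_carrier])
    also have "\<dots> = ?W * (?P * ?D) * ?E"
      by (rule right_mult_one_mat[OF WPD, symmetric])
    finally show ?thesis using True Suc by (simp add: Lambda_plus_eq run_dir_def)
  next
    case False
    have "?W * ?P * ?E = ?W * ?P"
      by (rule right_mult_one_mat[OF WP])
    moreover have "?W * ?P * (?D * ?W) = ?W * (?P * ?D) * ?W"
      by (simp add: assoc carr del: One_nat_def add_Suc_right)
    ultimately show ?thesis using False Suc by (simp add: Lambda_minus_eq run_dir_def)
  qed
  finally show ?case by (simp add: path_mat_append)
qed

lemma X_mat_eq: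
  "X_mat m q as = W_mat m * path_mat m q (full_steps as) *
    (if even (length as) then W_mat m else 1\<^sub>m (m + 1))"
  using mat_prod_Lambda[of m q "(!) as" "length as"]
  unfolding X_mat_def mat_prod_def full_steps_def by simp

text \<open>Source of the two cases of the theorem: the leading \<open>W\<close> reflects the row
  index, while the column index is reflected only by the final \<open>W\<close> of an even
  product.\<close>

lemma X_mat_index:
  assumes "r \<le> m" "c \<le> m"
  shows "X_mat m q as $$ (r, c) =
    path_mat m q (full_steps as) $$ (m - r, if even (length as) then m - c else c)"
proof -
  have carr: "W_mat m * path_mat m q (full_steps as) \<in> carrier_mat (m + 1) (m + 1)"
    by (rule mult_carrier_mat[OF W_mat_carrier path_mat_carrier])
  show ?thesis
    using assms W_mult_index[OF path_mat_carrier, of r m _ q "full_steps as"]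
      mult_W_index[OF carr assms] right_mult_one_mat[OF carr]
    unfolding X_mat_eq by simp
qed

subsection \<open>Entries of path matrices\<close>

text \<open>The starting height \<open>x\<close> is not part of the list and carries no weight.\<close>

definition height_paths :: "nat \<Rightarrow> direction list \<Rightarrow> nat \<Rightarrow> nat \<Rightarrow> nat list set" where
  "height_paths m ds x y =
     {zs. length zs = length ds \<and> set zs \<subseteq> {0..m} \<and> last (x # zs) = y \<and>
        (\<forall>t<length ds. step_rel (ds ! t) ((x # zs) ! t) (zs ! t))}"

lemma finite_height_paths: "finite (height_paths m ds x y)"
  by (rule finite_subset[OF _ finite_lists_length_eq[of "{0..m}" "length ds"]])
    (auto simp: height_paths_def)

lemma height_paths_Cons:
  "height_paths m (d # ds) x y =
    (\<Union>z\<in>{z. z \<le> m \<and> step_rel d x z}. (#) z ` height_paths m ds z y)"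
proof (rule Set.set_eqI)
  fix zs
  show "zs \<in> height_paths m (d # ds) x y \<longleftrightarrow>
    zs \<in> (\<Union>z\<in>{z. z \<le> m \<and> step_rel d x z}. (#) z ` height_paths m ds z y)"
    by (cases zs) (auto simp: height_paths_def All_less_Suc2)
qed

text \<open>The summation index of the matrix product is the first height after \<open>x\<close>.
  Sets of paths with different first heights are disjoint, so the sums combine along
  \<open>height_paths_Cons\<close>.\<close>

lemma path_mat_index:
  assumes "x \<le> m" "y \<le> m"
  shows "path_mat m q ds $$ (x, y) = (\<Sum>zs\<in>height_paths m ds x y. q ^ sum_list zs)"
  using assms(1)
proof (induction ds arbitrary: x)
  case Nil
  have "height_paths m [] x y = (if x = y then {[]} else {})"
    by (auto simp: height_paths_def)
  then show ?case using Nil assms by (simp add: path_mat_Nil)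
next
  case (Cons d ds)
  let ?Z = "{z. z \<le> m \<and> step_rel d x z}"
  have "path_mat m q (d # ds) $$ (x, y) =
      (\<Sum>z<m + 1. transfer_mat m q d $$ (x, z) * path_mat m q ds $$ (z, y))"
    unfolding path_mat_Cons
    by (rule index_mult_sum) (use Cons.prems assms in \<open>auto simp del: One_nat_def add_Suc_right\<close>)
  also have "\<dots> = (\<Sum>z<m + 1. if step_rel d x z then
      q ^ z * (\<Sum>zs\<in>height_paths m ds z y. q ^ sum_list zs) else 0)"
    using Cons by (intro sum.cong) (auto simp: transfer_mat_def)
  also have "\<dots> = (\<Sum>z\<in>?Z. q ^ z * (\<Sum>zs\<in>height_paths m ds z y. q ^ sum_list zs))"
    by (subst sum.inter_filter[symmetric]) (auto intro!: sum.cong)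
  also have "\<dots> = (\<Sum>z\<in>?Z. \<Sum>zs\<in>(#) z ` height_paths m ds z y. q ^ sum_list zs)"
    by (intro sum.cong refl) (simp add: sum.reindex sum_distrib_left power_add)
  also have "\<dots> = (\<Sum>zs\<in>height_paths m (d # ds) x y. q ^ sum_list zs)"
    unfolding height_paths_Cons
    by (rule sum.UNION_disjoint[symmetric]) (auto simp: finite_height_paths)
  finally show ?case .
qed

text \<open>The outer two steps become boundary conditions: the first, being upward, bounds the
  first box value by \<open>x\<close>, and the last compares the last box value with
  \<open>y\<close>. The list \<open>ss\<close> holds the box values, one more than there are steps
  in \<open>ds\<close>.\<close>

lemma height_paths_snoc:
  assumes "length ss = Suc (length ds)"
  shows "ss @ [z] \<in> height_paths m (Upwards # ds @ [d]) x y \<longleftrightarrow>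
    z = y \<and> y \<le> m \<and> set ss \<subseteq> {0..m} \<and> hd ss \<le> x \<and> step_rel d (last ss) y \<and>
    (\<forall>t<length ds. step_rel (ds ! t) (ss ! t) (ss ! Suc t))"
proof -
  obtain s ss' where ss: "ss = s # ss'" "length ss' = length ds"
    using assms by (cases ss) auto
  have snoc: "t \<le> length ds \<Longrightarrow> (s # ss' @ [y]) ! t = (s # ss') ! t" for t
    using ss(2) nth_append_left[of t "s # ss'" "[y]"] by simp
  have "last ss = ss ! length ds"
    using assms by (subst last_conv_nth) auto
  \<comment> \<open>Splits the steps into entry, the steps of \<open>ds\<close>, and exit.\<close>
  moreover have "(\<forall>t<Suc (Suc n). P t) \<longleftrightarrow> P 0 \<and> (\<forall>t<n. P (Suc t)) \<and> P (Suc n)" for P n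
    by (subst All_less_Suc2) (auto simp: All_less_Suc)
  ultimately show ?thesis
    using ss by (auto simp: height_paths_def nth_append snoc)
qed

subsection \<open>Heights along a border strip\<close>

definition walk :: "direction list \<Rightarrow> nat \<Rightarrow> box" where
  "walk ds p = foldl move (0, 0) (take p ds)"

lemma walk_Suc: "p < length ds \<Longrightarrow> walk ds (Suc p) = move (walk ds p) (ds ! p)"
  by (simp add: walk_def take_Suc_conv_app_nth)

text \<open>Each step raises exactly one coordinate by one, so the coordinate sum acts as a clock:
  it separates the boxes and orders those in a common row or column.\<close>

lemma walk_coord_sum: "p \<le> length ds \<Longrightarrow> fst (walk ds p) + snd (walk ds p) = int p"
proof (induction p)
  case 0
  then show ?case by (simp add: walk_def)
next
  case (Suc p)
  then show ?case
    by (cases "walk ds p"; cases "ds ! p") (auto simp: walk_Suc)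
qed

lemma inj_on_walk: "inj_on (walk ds) {..length ds}"
  by (rule inj_onI) (metis atMost_iff walk_coord_sum of_nat_eq_iff)

text \<open>The vertical coordinate never falls, so equal coordinates at both ends force every step
  between them to go right, and the local inequalities chain. The first conjunct carries this
  through the induction.\<close>

lemma walk_constant_row:
  assumes "p \<le> p'" "p' \<le> length ds"
    and steps: "\<And>t. t < length ds \<Longrightarrow> step_rel (ds ! t) (\<sigma> (walk ds t)) (\<sigma> (walk ds (Suc t)))"
  shows "snd (walk ds p) \<le> snd (walk ds p') \<and>
    (snd (walk ds p) = snd (walk ds p') \<longrightarrow> \<sigma> (walk ds p) \<le> \<sigma> (walk ds p'))"
  using assms(1,2)
proof (induction p' rule: dec_induct)
  case base
  then show ?case by simp
next
  case (step k)
  then show ?case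
    using steps[of k] by (cases "walk ds k"; cases "ds ! k") (auto simp: walk_Suc)
qed

lemma walk_constant_column:
  assumes "p \<le> p'" "p' \<le> length ds"
    and steps: "\<And>t. t < length ds \<Longrightarrow> step_rel (ds ! t) (\<sigma> (walk ds t)) (\<sigma> (walk ds (Suc t)))"
  shows "fst (walk ds p) \<le> fst (walk ds p') \<and>
    (fst (walk ds p) = fst (walk ds p') \<longrightarrow> \<sigma> (walk ds p') \<le> \<sigma> (walk ds p))"
  using assms(1,2)
proof (induction p' rule: dec_induct)
  case base
  then show ?case by simp
next
  case (step k)
  then show ?case
    using steps[of k] by (cases "walk ds k"; cases "ds ! k") (auto simp: walk_Suc)
qed

text \<open>Row and column conditions on all pairs reduce to consecutive boxes: neighbours share a
  row or column, and two boxes of a common row or column are joined by a straight piece of the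
  walk.\<close>

lemma P_partitions_walk:
  "\<sigma> \<in> P_partitions m (walk ds ` {..length ds}) \<longleftrightarrow>
    \<sigma> \<in> walk ds ` {..length ds} \<rightarrow>\<^sub>E {0..m} \<and>
    (\<forall>t<length ds. step_rel (ds ! t) (\<sigma> (walk ds t)) (\<sigma> (walk ds (Suc t))))"
    (is "_ \<in> P_partitions m ?G \<longleftrightarrow> ?E \<and> ?S")
proof (intro iffI conjI)
  assume P: "\<sigma> \<in> P_partitions m ?G"
  then show ?E by (simp add: P_partitions_def)
  show ?S
  proof (intro allI impI)
    fix t assume t: "t < length ds"
    obtain x y where xy: "walk ds t = (x, y)" by force
    have "walk ds t \<in> ?G" "walk ds (Suc t) \<in> ?G" using t by auto
    then show "step_rel (ds ! t) (\<sigma> (walk ds t)) (\<sigma> (walk ds (Suc t)))"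
      using P walk_Suc[OF t] xy by (cases "ds ! t") (auto simp: P_partitions_def)
  qed
next
  assume "?E \<and> ?S"
  then have E: ?E and S: "\<And>t. t < length ds \<Longrightarrow>
      step_rel (ds ! t) (\<sigma> (walk ds t)) (\<sigma> (walk ds (Suc t)))"
    by auto
  have "\<sigma> (x, y) \<le> \<sigma> (x', y)" if xy: "(x, y) \<in> ?G" "(x', y) \<in> ?G" "x \<le> x'" for x x' y
  proof -
    obtain p p' where p: "p \<le> length ds" "walk ds p = (x, y)" "p' \<le> length ds" "walk ds p' = (x', y)"
      using xy(1,2) by (metis atMost_iff imageE)
    \<comment> \<open>Within a row, the clock turns \<open>x \<le> x'\<close> into the order of
      visits.\<close>
    then have "p \<le> p'"
      using walk_coord_sum[OF p(1)] walk_coord_sum[OF p(3)] xy(3) by simp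
    then show ?thesis using walk_constant_row[OF _ p(3) S] p by force
  qed
  moreover have "\<sigma> (x, y') \<le> \<sigma> (x, y)" if xy: "(x, y) \<in> ?G" "(x, y') \<in> ?G" "y \<le> y'" for x y y'
  proof -
    obtain p p' where p: "p \<le> length ds" "walk ds p = (x, y)" "p' \<le> length ds" "walk ds p' = (x, y')"
      using xy(1,2) by (metis atMost_iff imageE)
    then have "p \<le> p'"
      using walk_coord_sum[OF p(1)] walk_coord_sum[OF p(3)] xy(3) by simp
    then show ?thesis using walk_constant_column[OF _ p(3) S] p by force
  qed
  ultimately show "\<sigma> \<in> P_partitions m ?G" using E by (auto simp: P_partitions_def)
qed

text \<open>A box \<open>(x, y)\<close> of the walk is visited at time \<open>x + y\<close>, which inverts the passage from a
  \<open>P\<close>-partition to its list of values.\<close>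

lemma sum_height_paths_eq_sum_P_partitions:
  fixes q :: "'a::comm_ring_1" and ds :: "direction list"
  assumes "y \<le> m"
  defines "G \<equiv> walk ds ` {..length ds}"
  shows "(\<Sum>zs\<in>height_paths m (Upwards # ds @ [d]) x y. q ^ sum_list zs) =
    q ^ y * (\<Sum>\<sigma>\<in>{\<sigma> \<in> P_partitions m G. \<sigma> (walk ds 0) \<le> x \<and>
      step_rel d (\<sigma> (walk ds (length ds))) y}. q ^ wt G \<sigma>)"
proof -
  let ?N = "Suc (length ds)"
  let ?H = "height_paths m (Upwards # ds @ [d]) x y"
  let ?S = "{\<sigma> \<in> P_partitions m G. \<sigma> (walk ds 0) \<le> x \<and> step_rel d (\<sigma> (walk ds (length ds))) y}"
  let ?vals = "\<lambda>\<sigma>. map (\<lambda>p. \<sigma> (walk ds p)) [0..<?N]"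
  \<comment> \<open>Boxes of \<open>G\<close> are visited at times \<open>0\<close> to
    \<open>length ds\<close>, so the exit height at the end of \<open>zs\<close> is not read.
    \<open>restrict\<close> gives \<open>undefined\<close> outside \<open>G\<close>, as the
    extensional function space demands.\<close>
  let ?fill = "\<lambda>zs. restrict (\<lambda>b. zs ! nat (fst b + snd b)) G"
  have fill: "?fill zs (walk ds p) = zs ! p" if "p \<le> length ds" for zs :: "nat list" and p
    using that walk_coord_sum[OF that] by (auto simp: G_def)
  have wt: "sum_list (?vals \<sigma>) = wt G \<sigma>" for \<sigma>
  proof -
    have "wt G \<sigma> = (\<Sum>p\<le>length ds. \<sigma> (walk ds p))"
      unfolding wt_def G_def by (rule sum.reindex_cong[OF inj_on_walk]) simp_all
    also have "{..length ds} = set [0..<?N]" by auto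
    finally show ?thesis unfolding interv_sum_list_conv_sum_set_nat ..
  qed
  have mem: "?vals \<sigma> @ [y] \<in> ?H \<longleftrightarrow> \<sigma> \<in> ?S" if "\<sigma> \<in> G \<rightarrow>\<^sub>E {0..m}" for \<sigma>
  proof -
    have set: "set (?vals \<sigma>) \<subseteq> {0..m}"
      using that by (auto simp: G_def simp del: upt_Suc)
    have hd: "hd (?vals \<sigma>) = \<sigma> (walk ds 0)"
      by (simp add: hd_map del: upt_Suc)
    have last: "last (?vals \<sigma>) = \<sigma> (walk ds (length ds))" by simp
    show ?thesis
      using that assms(1) set P_partitions_walk[of \<sigma> m ds] hd last
      by (subst height_paths_snoc) (auto simp: G_def simp del: upt_Suc)
  qed
  have split: "zs = ?vals (?fill zs) @ [y] \<and> ?fill zs \<in> ?S" if "zs \<in> ?H" for zs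
  proof -
    \<comment> \<open>One entry per box plus the exit height, which is \<open>y\<close>.\<close>
    have len: "length zs = Suc ?N" and last: "last zs = y" and set: "set zs \<subseteq> {0..m}"
      using that by (auto simp: height_paths_def split: if_splits)
    have "?vals (?fill zs) = take ?N zs"
      by (rule nth_equalityI) (use len fill in \<open>auto simp del: upt_Suc restrict_apply\<close>)
    moreover have "zs = take ?N zs @ [y]"
      using len last by (metis append_butlast_last_id butlast_conv_take diff_Suc_1 length_0_conv nat.distinct(1))
    ultimately have eq: "zs = ?vals (?fill zs) @ [y]" by simp
    have "?fill zs \<in> G \<rightarrow>\<^sub>E {0..m}"
    proof (rule restrict_PiE_iff[THEN iffD2], rule ballI)
      fix b assume "b \<in> G"
      then obtain p where "p \<le> length ds" "b = walk ds p" by (auto simp: G_def)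
      then show "zs ! nat (fst b + snd b) \<in> {0..m}"
        using walk_coord_sum[of p ds] len subsetD[OF set nth_mem[of p]] by auto
    qed
    then show ?thesis using mem[of "?fill zs"] eq that by simp
  qed
  \<comment> \<open>\<open>?vals\<close> and \<open>?fill\<close> are mutually inverse once the exit
    height is appended or dropped; that height contributes the factor \<open>q ^ y\<close>.\<close>
  have "(\<Sum>zs\<in>?H. q ^ sum_list zs) = (\<Sum>\<sigma>\<in>?S. q ^ y * q ^ wt G \<sigma>)"
  proof (rule sum.reindex_bij_witness[where i = "\<lambda>\<sigma>. ?vals \<sigma> @ [y]" and j = ?fill])
    fix zs assume zs: "zs \<in> ?H"
    show "?vals (?fill zs) @ [y] = zs" "?fill zs \<in> ?S" using split[OF zs] by simp_all
    have "q ^ sum_list (?vals (?fill zs) @ [y]) = q ^ y * q ^ wt G (?fill zs)"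
      unfolding sum_list.append wt by (simp add: power_add mult.commute)
    then show "q ^ y * q ^ wt G (?fill zs) = q ^ sum_list zs"
      using split[OF zs] by metis
  next
    fix \<sigma> assume \<sigma>: "\<sigma> \<in> ?S"
    then have E: "\<sigma> \<in> G \<rightarrow>\<^sub>E {0..m}" by (auto simp: P_partitions_def)
    show "?vals \<sigma> @ [y] \<in> ?H" using mem[OF E] \<sigma> by blast
    show "?fill (?vals \<sigma> @ [y]) = \<sigma>"
    proof (rule PiE_ext[OF _ E])
      show "?fill (?vals \<sigma> @ [y]) \<in> G \<rightarrow>\<^sub>E {0..m}"
        using split[OF \<open>?vals \<sigma> @ [y] \<in> ?H\<close>] by (auto simp: P_partitions_def)
    next
      fix b assume "b \<in> G"
      then obtain p where "p \<le> length ds" "b = walk ds p" by (auto simp: G_def)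
      then show "?fill (?vals \<sigma> @ [y]) b = \<sigma> b"
        using fill[of p "?vals \<sigma> @ [y]"] by (simp add: nth_append del: upt_Suc)
    qed
  qed
  then show ?thesis by (simp add: sum_distrib_left)
qed

subsection \<open>The steps of the strip\<close>

lemma length_full_steps: "length (full_steps as) = sum_list as"
  by (simp add: full_steps_def length_concat comp_def sum_list_sum_nth interv_sum_list_conv_sum_set_nat)

text \<open>\<open>run_length\<close> removes one step from each end of the full word: the step into
  the first box and the step out of the last. The bound \<open>sum_list as \<ge> 2\<close> excludes
  \<open>[1]\<close>, whose only step would have to be both.\<close>

lemma full_steps_eq:
  assumes "as \<noteq> []" "\<forall>a\<in>set as. a \<ge> 1" "sum_list as \<ge> 2"
  shows "full_steps as = Upwards # strip_steps as @ [run_dir (length as - 1)]"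
proof (cases "length as = 1")
  case True
  then obtain a where "as = [a]" by (auto simp: length_Suc_conv)
  moreover obtain b where "a = Suc (Suc b)"
    using assms(3) \<open>as = [a]\<close> by (auto simp: numeral_2_eq_2 le_iff_add)
  ultimately show ?thesis
    by (simp add: full_steps_def strip_steps_def run_length_def run_dir_def replicate_append_same)
next
  case False
  \<comment> \<open>\<open>n\<close> counts the inner runs, which keep their full length; runs
    \<open>0\<close> and \<open>Suc n\<close> lose one step each.\<close>
  define n where "n = length as - 2"
  have n: "length as = Suc (Suc n)" using False assms(1) by (cases as; cases "tl as") (auto simp: n_def)
  have upt: "[0..<length as] = 0 # [1..<Suc n] @ [Suc n]"
    using n by (simp add: upt_conv_Cons del: upt_Suc) (simp add: upt_conv_Cons)
  have mid: "map (\<lambda>k. replicate (run_length as k) (if even k then Upwards else Rightwards)) [1..<Suc n]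
      = map (\<lambda>k. replicate (as ! k) (run_dir k)) [1..<Suc n]"
    using n by (intro map_cong) (auto simp: run_length_def run_dir_def)
  obtain b where b: "as ! 0 = Suc b"
    using assms(2) n by (metis One_nat_def Suc_le_D nth_mem zero_less_Suc)
  obtain c where c: "as ! Suc n = Suc c"
    using assms(2) n by (metis One_nat_def Suc_le_D nth_mem lessI)
  have last: "replicate (Suc c) e = replicate c e @ [e]" for e :: direction
    by (simp add: replicate_append_same)
  show ?thesis
    unfolding full_steps_def strip_steps_def upt list.map map_append concat.simps concat_append mid
    using n b c by (simp add: run_length_def run_dir_def last del: upt_Suc replicate_Suc)
      (simp add: replicate_append_same)
qed

lemma strip_box_eq_walk: "strip_box as (Suc p) = walk (strip_steps as) p"
  by (simp add: strip_box_def walk_def)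

lemma border_strip_eq_walk:
  assumes "num_boxes as = Suc (length (strip_steps as))"
  shows "border_strip as = walk (strip_steps as) ` {..length (strip_steps as)}"
proof -
  have "{1..num_boxes as} = Suc ` {..length (strip_steps as)}"
    using assms by (simp add: atMost_atLeast0)
  then show ?thesis by (simp add: border_strip_def image_image strip_box_eq_walk)
qed

section \<open>Entries of \<open>X\<close> as generating functions\<close>

lemma X_mat_entry_nonempty_strip:
  fixes q :: "'a::comm_ring_1"
  assumes "as \<noteq> []" "\<forall>a\<in>set as. a \<ge> 1" "sum_list as \<ge> 2"
    and "1 \<le> i" "i \<le> m + 1" "1 \<le> j" "j \<le> m + 1"
  shows "X_mat m q as $$ (i - 1, j - 1) =
    (if even (length as) then q ^ (m + 1 - j) * Omega_gf m as i j q
     else q ^ (j - 1) * Omega_bar_gf m as i j q)"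
proof -
  define ds where "ds = strip_steps as"
  define d where "d = run_dir (length as - 1)"
  \<comment> \<open>The exit height: the zero-based column index \<open>j - 1\<close>, reflected to
    \<open>m - (j - 1)\<close> for even length.\<close>
  define y where "y = (if even (length as) then m + 1 - j else j - 1)"
  have full: "full_steps as = Upwards # ds @ [d]"
    unfolding ds_def d_def by (rule full_steps_eq[OF assms(1-3)])
  have N: "num_boxes as = Suc (length ds)"
    using length_full_steps[of as] full by (simp add: num_boxes_def)
  have G: "border_strip as = walk ds ` {..length ds}"
    using border_strip_eq_walk N by (simp add: ds_def)
  have d: "d = (if even (length as) then Rightwards else Upwards)"
    using assms(1) by (auto simp: d_def run_dir_def)
  have y: "y \<le> m" using assms by (auto simp: y_def)
  \<comment> \<open>The exit step bounds the last value by \<open>y\<close>: from above when it goes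
    right (even length), from below when it goes up (odd length).\<close>
  have Omega: "{\<sigma> \<in> P_partitions m (border_strip as). \<sigma> (walk ds 0) \<le> m + 1 - i \<and>
      step_rel d (\<sigma> (walk ds (length ds))) y} =
      (if even (length as) then Omega m as i j else Omega_bar m as i j)"
    using N by (auto simp: Omega_def Omega_bar_def d y_def strip_box_eq_walk ds_def)
  have "X_mat m q as $$ (i - 1, j - 1) = path_mat m q (full_steps as) $$ (m + 1 - i, y)"
    using assms X_mat_index[of "i - 1" m "j - 1" q as] by (simp add: y_def)
  also have "\<dots> = (\<Sum>zs\<in>height_paths m (Upwards # ds @ [d]) (m + 1 - i) y. q ^ sum_list zs)"
    unfolding full by (rule path_mat_index) (use assms y in auto)
  also have "\<dots> = q ^ y * (\<Sum>\<sigma>\<in>(if even (length as) then Omega m as i j else Omega_bar m as i j).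
      q ^ wt (border_strip as) \<sigma>)"
    unfolding sum_height_paths_eq_sum_P_partitions[OF y] G[symmetric] Omega ..
  finally show ?thesis by (simp add: y_def Omega_gf_def Omega_bar_gf_def)
qed

text \<open>A single upward step is entry and exit at once, leaving the direct comparison of
  \<open>m + 1 - i\<close> with \<open>j - 1\<close> that \<open>Omega_bar\<close> prescribes for
  the empty strip.\<close>

lemma X_mat_entry_empty_strip:
  fixes q :: "'a::comm_ring_1"
  assumes "1 \<le> i" "i \<le> m + 1" "1 \<le> j" "j \<le> m + 1"
  shows "X_mat m q [1] $$ (i - 1, j - 1) = q ^ (j - 1) * Omega_bar_gf m [1] i j q"
proof -
  have "X_mat m q [1] $$ (i - 1, j - 1) = path_mat m q (full_steps [1]) $$ (m + 1 - i, j - 1)"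
    using assms X_mat_index[of "i - 1" m "j - 1" q "[1]"] by simp
  also have "path_mat m q (full_steps [1]) = transfer_mat m q Upwards"
    using right_mult_one_mat[OF transfer_mat_carrier, of m q Upwards]
    by (simp add: full_steps_def run_dir_def path_mat_Cons path_mat_Nil)
  also have "transfer_mat m q Upwards $$ (m + 1 - i, j - 1) =
      (if j - 1 \<le> m + 1 - i then q ^ (j - 1) else 0)"
    using assms by (auto simp: transfer_mat_def)
  \<comment> \<open>The only extensional function on no boxes is constantly
    \<open>undefined\<close>; its weight is 0, so the generating function is 1 or 0.\<close>
  also have "\<dots> = q ^ (j - 1) * Omega_bar_gf m [1] i j q"
    by (simp add: Omega_bar_gf_def Omega_bar_def border_strip_def num_boxes_def P_partitions_def wt_def)
  finally show ?thesis .
qed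

theorem theoremA:
  fixes m i j :: nat and as :: "nat list" and q :: "'a::comm_ring_1"
  assumes "m \<ge> 1"
    and "as \<noteq> []"
    and "\<forall>a\<in>set as. a \<ge> 1"
    and "1 \<le> i" "i \<le> m + 1"
    and "1 \<le> j" "j \<le> m + 1"
  shows "X_mat m q as $$ (i - 1, j - 1) =
    (if even (length as) then q ^ (m + 1 - j) * Omega_gf m as i j q
     else q ^ (j - 1) * Omega_bar_gf m as i j q)"
proof (cases "sum_list as \<ge> 2")
  case True
  then show ?thesis using X_mat_entry_nonempty_strip assms(2-) by blast
next
  \<comment> \<open>Positive entries with sum below 2 leave only \<open>[1]\<close>.\<close>
  case False
  obtain a as' where as: "as = a # as'" using assms(2) by (cases as) auto
  with False assms(3) have "as' = []" by (cases as') auto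
  moreover from this as False assms(3) have "a = 1" by simp
  ultimately show ?thesis using X_mat_entry_empty_strip[OF assms(4-7)] as by simp
qed

end
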